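(* For every positive integer $d\ge 3$ there exists a Meyniel extremal family whose graphs are regular and have diameter at least $d$.
   Context: All graphs are finite, simple, undirected and connected. Let $I$ be an infinite set of positive integers. A family of graphs $\{G_n\}_{n\in I}$ with $G_n$ of order $n$ is Meyniel extremal if there is a constant $a>0$ with $c(G_n)\ge a\sqrt n$ for all $n\in I$, where $c$ denotes the cop number. Cops and Robbers on a graph $G$: in round $0$ the cops choose vertices to occupy, then the robber chooses a vertex. In each later round the cops move first and then the robber. On a move, each player moves to a neighboring vertex or stays put; any subset of the cops may move. Both sides have complete information. The cops win if after finitely many rounds some cop occupies the robber's vertex; otherwise the robber wins. The cop number $c(G)$ is the minimum number of cops that guarantees a win for the cops. *)

theory Defs
  imports Complex_Main "Graph_Theory.Graph_Theory"
begin

text \<open>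
  Graphs are symmetric digraphs without loops or parallel arcs (locale \<^locale>\<open>pair_graph\<close>),
  so the out-degree of a vertex is its number of neighbours.
\<close>

definition regular :: "('a, 'b) pre_digraph \<Rightarrow> bool" where
  "regular G \<longleftrightarrow> (\<exists>r. \<forall>v \<in> verts G. out_degree G v = r)"

text \<open>With unit weights \<open>wf_digraph.\<mu>\<close> is the usual distance (\<open>\<infinity>\<close> if there is no path).\<close>

definition graph_diameter :: "('a, 'b) pre_digraph \<Rightarrow> ereal" where
  "graph_diameter G = (SUP u \<in> verts G. SUP v \<in> verts G. wf_digraph.\<mu> G (\<lambda>_. 1) u v)"


subsection \<open>Cops and Robbers\<close>

definition legal_move :: "('a, 'b) pre_digraph \<Rightarrow> 'a \<Rightarrow> 'a \<Rightarrow> bool" where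
  "legal_move G u v \<longleftrightarrow> u \<in> verts G \<and> v \<in> verts G \<and> (u = v \<or> u \<rightarrow>\<^bsub>G\<^esub> v)"

text \<open>\<open>r t\<close> is the position of the robber at the end of round \<open>t\<close>.\<close>

definition robber_play :: "('a, 'b) pre_digraph \<Rightarrow> (nat \<Rightarrow> 'a) \<Rightarrow> bool" where
  "robber_play G r \<longleftrightarrow> r 0 \<in> verts G \<and> (\<forall>t. legal_move G (r t) (r (Suc t)))"

text \<open>
  A cop strategy maps the robber's positions so far, in chronological order, to the next
  position of each cop; the cops' own earlier positions are determined by the strategy and
  these data. The empty history gives the initial placement. Hence \<open>cop_pos s r t i\<close> is the
  position of cop \<open>i\<close> after the cops have moved in round \<open>t\<close>, when the robber has shown
  \<open>r 0, \<dots>, r (t - 1)\<close>.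
\<close>

type_synonym 'a cop_strategy = "'a list \<Rightarrow> nat \<Rightarrow> 'a"

definition cop_pos :: "'a cop_strategy \<Rightarrow> (nat \<Rightarrow> 'a) \<Rightarrow> nat \<Rightarrow> nat \<Rightarrow> 'a" where
  "cop_pos s r t = s (map r [0..<t])"

definition legal_cop_strategy :: "('a, 'b) pre_digraph \<Rightarrow> nat \<Rightarrow> 'a cop_strategy \<Rightarrow> bool" where
  "legal_cop_strategy G k s \<longleftrightarrow>
     (\<forall>i<k. s [] i \<in> verts G) \<and>
     (\<forall>r. robber_play G r \<longrightarrow>
        (\<forall>t. \<forall>i<k. legal_move G (cop_pos s r t i) (cop_pos s r (Suc t) i)))"

text \<open>
  In round \<open>t\<close> the robber is caught either by his own placement or move (first disjunct), or
  by the cops' next move (second disjunct). Positions after a capture are immaterial, so plays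
  are taken to be infinite.
\<close>

definition robber_caught :: "nat \<Rightarrow> 'a cop_strategy \<Rightarrow> (nat \<Rightarrow> 'a) \<Rightarrow> bool" where
  "robber_caught k s r \<longleftrightarrow>
     (\<exists>t. \<exists>i<k. cop_pos s r t i = r t \<or> cop_pos s r (Suc t) i = r t)"

definition cops_win :: "('a, 'b) pre_digraph \<Rightarrow> nat \<Rightarrow> bool" where
  "cops_win G k \<longleftrightarrow>
     (\<exists>s. legal_cop_strategy G k s \<and> (\<forall>r. robber_play G r \<longrightarrow> robber_caught k s r))"

definition cop_number :: "('a, 'b) pre_digraph \<Rightarrow> nat" where
  "cop_number G = (LEAST k. cops_win G k)"

text \<open>
  As graphs are considered up to isomorphism, vertices may be taken to be natural numbers.
  Only the values of \<open>G\<close> on \<open>I\<close> matter.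
\<close>

definition Meyniel_extremal :: "nat set \<Rightarrow> (nat \<Rightarrow> nat pair_pre_digraph) \<Rightarrow> bool" where
  "Meyniel_extremal I G \<longleftrightarrow>
     infinite I \<and> 0 \<notin> I \<and>
     (\<forall>n \<in> I. pair_graph (G n) \<and> Digraph_Component.connected (with_proj (G n)) \<and>
              card (pverts (G n)) = n) \<and>
     (\<exists>a::real. a > 0 \<and> (\<forall>n \<in> I. real (cop_number (with_proj (G n))) \<ge> a * sqrt (real n)))"

end

theory Submission
  imports Defs "HOL-Computational_Algebra.Primes"
begin

text \<open>
  The cop number is bounded below by a purely local argument. Suppose every vertex has at least
  \<open>\<delta>\<close> neighbours and any two distinct vertices have at most \<open>K\<close> common neighbours. A cop who does
  not stand on the robber's vertex \<open>u\<close> threatens at most \<open>K + 1\<close> neighbours of \<open>u\<close>: its own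
  position and the common neighbours. So as long as \<open>k * (K + 1) < \<delta>\<close>, the robber always has an
  unthreatened neighbour to flee to, and \<open>k\<close> cops lose. Hence a family with bounded codegrees
  whose degrees grow like \<open>\<surd>n\<close> is Meyniel extremal.

  Such graphs come from planes over \<open>\<int>/p\<close>: join the point \<open>(x, y)\<close> to the line \<open>(m, b)\<close> when
  \<open>y + b = x * m\<close>. There are \<open>p\<^sup>2\<close> points and \<open>p\<^sup>2\<close> lines, all degrees are \<open>p\<close>, and two points lie
  on at most one common line because \<open>\<int>/p\<close> is a field; the relation is symmetric, so the same
  holds for lines.

  To reach diameter \<open>d\<close> without losing regularity, take \<open>2 * d\<close> layers, each a copy of
  \<open>(\<int>/p)\<^sup>2\<close>, arranged in a cycle. Consecutive layers are joined alternately by the incidence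
  relation and by the identity matching. Every vertex then has degree \<open>p + 1\<close>; the
  matching contributes only one edge per vertex, so codegrees are at most \<open>3\<close> (lemma
  \<open>card_common_nbrs\<close>) and the cop number is at least \<open>(p + 1) / 4\<close>. The order is \<open>2 * d * p\<^sup>2\<close>,
  and for fixed \<open>d\<close> this makes the cop number at least a constant times the square root of
  the order. An edge changes the layer by one step around the cycle, hence opposite layers are at
  distance at least \<open>d\<close>. Letting \<open>p\<close> run through the primes gives the family.
\<close>

section \<open>Evading cops in graphs with small codegrees\<close>

definition neighbours :: "('a, 'b) pre_digraph \<Rightarrow> 'a \<Rightarrow> 'a set" where
  "neighbours G u = {v. u \<rightarrow>\<^bsub>G\<^esub> v}"

text \<open>
  By counting: a cop off \<open>u\<close> threatens only those neighbours of \<open>u\<close> that are its own position or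
  common neighbours, hence at most \<open>K + 1\<close> of them.
\<close>

lemma safe_neighbour_exists:
  assumes codeg: "\<And>v. v \<in> verts G \<Longrightarrow> v \<noteq> u \<Longrightarrow> card (neighbours G u \<inter> neighbours G v) \<le> K"
    and cops: "\<And>i. i < k \<Longrightarrow> c i \<in> verts G \<and> c i \<noteq> u"
    and few: "k * (K + 1) < card (neighbours G u)"
  shows "\<exists>v. u \<rightarrow>\<^bsub>G\<^esub> v \<and> (\<forall>i<k. \<not> legal_move G (c i) v)"
proof (rule ccontr)
  assume no_escape: "\<not> ?thesis"
  have fin: "finite (neighbours G u)"
    using few card.infinite by fastforce
  have "neighbours G u \<subseteq> (\<Union>i<k. insert (c i) (neighbours G u \<inter> neighbours G (c i)))"
    using no_escape by (fastforce simp: neighbours_def legal_move_def)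
  then have "card (neighbours G u) \<le> card (\<Union>i<k. insert (c i) (neighbours G u \<inter> neighbours G (c i)))"
    using fin by (intro card_mono) auto
  also have "\<dots> \<le> (\<Sum>i<k. card (insert (c i) (neighbours G u \<inter> neighbours G (c i))))"
    by (rule card_UN_le) simp
  also have "\<dots> \<le> (\<Sum>i<k. K + 1)"
  proof (rule sum_mono)
    fix i assume "i \<in> {..<k}"
    then have "card (neighbours G u \<inter> neighbours G (c i)) \<le> K"
      using cops codeg by simp
    moreover have "card (insert (c i) (neighbours G u \<inter> neighbours G (c i)))
        \<le> Suc (card (neighbours G u \<inter> neighbours G (c i)))"
      by (rule card_insert_le_m1) auto
    ultimately show "card (insert (c i) (neighbours G u \<inter> neighbours G (c i))) \<le> K + 1"
      by linarith
  qed
  finally show False using few by simp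
qed

primrec history :: "('a list \<Rightarrow> 'a) \<Rightarrow> nat \<Rightarrow> 'a list" where
  "history f 0 = []"
| "history f (Suc t) = history f t @ [f (history f t)]"

text \<open>
  A robber who answers a cop strategy determines his play by course-of-values recursion: his next
  position depends on all his earlier ones, since these are what the strategy sees.
\<close>

lemma exists_sequence_by_history: "\<exists>r. \<forall>t. r t = f (map r [0..<t])"
proof -
  define r where "r t = f (history f t)" for t
  have "history f t = map r [0..<t]" for t
    by (induction t) (auto simp: r_def)
  then show ?thesis unfolding r_def by metis
qed

text \<open>
  The robber keeps the invariant that no cop can reach him in one move. It guarantees that the
  cops' next move misses him, so that the counting lemma applies and restores the invariant.
\<close>

lemma robber_evades_few_cops:
  assumes "wf_digraph G" and ne: "verts G \<noteq> {}"
    and few: "\<And>u. u \<in> verts G \<Longrightarrow> k * (K + 1) < card (neighbours G u)"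
    and codeg: "\<And>u v. u \<in> verts G \<Longrightarrow> v \<in> verts G \<Longrightarrow> u \<noteq> v \<Longrightarrow>
                  card (neighbours G u \<inter> neighbours G v) \<le> K"
  shows "\<not> cops_win G k"
proof
  interpret wf_digraph G by fact
  assume "cops_win G k"
  then obtain s where legal: "legal_cop_strategy G k s"
    and win: "\<And>r. robber_play G r \<Longrightarrow> robber_caught k s r"
    unfolding cops_win_def by blast
  define safe where "safe h v \<longleftrightarrow> v \<in> verts G \<and> (\<forall>i<k. \<not> legal_move G (s h i) v)" for h v
  have placed: "s [] i \<in> verts G" if "i < k" for i
    using legal that by (simp add: legal_cop_strategy_def)
  have escape: "\<exists>v. u \<rightarrow>\<^bsub>G\<^esub> v \<and> safe h v"
    if "u \<in> verts G" "\<And>i. i < k \<Longrightarrow> s h i \<in> verts G \<and> s h i \<noteq> u" for h u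
    using safe_neighbour_exists[of G u K k "s h"] codeg[of u] few[of u] that adj_in_verts
    unfolding safe_def by metis
  have start: "\<exists>v. safe [] v"
  proof -
    \<comment> \<open>A vertex free of cops suffices, as it has a safe neighbour; one exists because
      the neighbourhood of any vertex is too large to be occupied entirely.\<close>
    obtain w where "w \<in> verts G" using ne by blast
    have "\<not> neighbours G w \<subseteq> s [] ` {..<k}"
    proof
      assume "neighbours G w \<subseteq> s [] ` {..<k}"
      then have "card (neighbours G w) \<le> card (s [] ` {..<k})" by (intro card_mono) auto
      also have "\<dots> \<le> k" using card_image_le[of "{..<k}" "s []"] by simp
      finally show False using few[OF \<open>w \<in> verts G\<close>] by simp
    qed
    then obtain u where "u \<in> verts G" "\<And>i. i < k \<Longrightarrow> s [] i \<noteq> u"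
      using adj_in_verts by (force simp: neighbours_def)
    then show ?thesis using escape placed by blast
  qed
  (* If there is no safe move, the robber stays put. This makes his play legal
     unconditionally, so the legality of the cops' moves can be used to prove the invariant. *)
  define f where "f h = (if h = [] then SOME v. safe [] v
      else if \<exists>v. last h \<rightarrow>\<^bsub>G\<^esub> v \<and> safe h v then SOME v. last h \<rightarrow>\<^bsub>G\<^esub> v \<and> safe h v
      else last h)" for h
  obtain r where r: "\<And>t. r t = f (map r [0..<t])"
    using exists_sequence_by_history[of f] by blast
  have r0: "safe [] (r 0)"
    using someI_ex[OF start] by (simp add: r[of 0] f_def)
  have step: "if \<exists>v. r t \<rightarrow>\<^bsub>G\<^esub> v \<and> safe (map r [0..<Suc t]) v
     then r t \<rightarrow>\<^bsub>G\<^esub> r (Suc t) \<and> safe (map r [0..<Suc t]) (r (Suc t)) else r (Suc t) = r t" for t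
  proof (cases "\<exists>v. r t \<rightarrow>\<^bsub>G\<^esub> v \<and> safe (map r [0..<Suc t]) v")
    case True
    then have "r (Suc t) = (SOME v. r t \<rightarrow>\<^bsub>G\<^esub> v \<and> safe (map r [0..<Suc t]) v)"
      by (subst r) (simp add: f_def)
    then show ?thesis using True someI_ex[OF True] by simp
  next
    case False
    then have "f (map r [0..<Suc t]) = r t"
      by (auto simp: f_def)
    then have "r (Suc t) = r t"
      by (subst r)
    then show ?thesis using False by auto
  qed
  have in_verts: "r t \<in> verts G" for t
  proof (induction t)
    case 0
    then show ?case using r0 by (simp add: safe_def)
  next
    case (Suc t)
    then show ?case using step[of t] adj_in_verts by (metis (lifting))
  qed
  have play: "robber_play G r"
    unfolding robber_play_def legal_move_def using in_verts step by metis
  have cop_move: "legal_move G (cop_pos s r t i) (cop_pos s r (Suc t) i)" if "i < k" for t i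
    using legal play that by (simp add: legal_cop_strategy_def)
  have evades: "safe (map r [0..<t]) (r t)" for t
  proof (induction t)
    case 0
    then show ?case using r0 by simp
  next
    case (Suc t)
    have "s (map r [0..<Suc t]) i \<in> verts G \<and> s (map r [0..<Suc t]) i \<noteq> r t" if "i < k" for i
      using cop_move[OF that, of t] Suc that unfolding safe_def cop_pos_def
      by (metis legal_move_def)
    from escape[OF in_verts this] show ?case using step[of t] by (metis (lifting))
  qed
  obtain t i where "i < k" "cop_pos s r t i = r t \<or> cop_pos s r (Suc t) i = r t"
    using win[OF play] unfolding robber_caught_def by blast
  then have "legal_move G (cop_pos s r t i) (r t)"
    using cop_move[of i t] in_verts by (auto simp: legal_move_def)
  then show False using evades[of t] \<open>i < k\<close> unfolding safe_def cop_pos_def by blast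
qed

text \<open>
  Needed to know that some number of cops wins, so that the least element defining the cop number
  is attained.
\<close>

lemma cops_on_all_vertices_win:
  assumes "finite (verts G)"
  shows "cops_win G (card (verts G))"
proof -
  obtain e where e: "bij_betw e {0..<card (verts G)} (verts G)"
    using ex_bij_betw_nat_finite[OF assms] by blast
  have mem: "e i \<in> verts G" if "i < card (verts G)" for i
    using bij_betwE[OF e] that by simp
  have "robber_caught (card (verts G)) (\<lambda>_. e) r" if "robber_play G r" for r
  proof -
    have "r 0 \<in> e ` {0..<card (verts G)}"
      using that e by (simp add: robber_play_def bij_betw_def)
    then obtain i where "i < card (verts G)" "e i = r 0" by auto
    then show ?thesis unfolding robber_caught_def cop_pos_def by blast
  qed
  moreover have "legal_cop_strategy G (card (verts G)) (\<lambda>_. e)"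
    using mem by (simp add: legal_cop_strategy_def cop_pos_def legal_move_def)
  ultimately show ?thesis unfolding cops_win_def by blast
qed

theorem cop_number_ge_degree_over_codegree:
  assumes "fin_digraph G" "verts G \<noteq> {}"
    and deg: "\<And>u. u \<in> verts G \<Longrightarrow> \<delta> \<le> card (neighbours G u)"
    and codeg: "\<And>u v. u \<in> verts G \<Longrightarrow> v \<in> verts G \<Longrightarrow> u \<noteq> v \<Longrightarrow>
                  card (neighbours G u \<inter> neighbours G v) \<le> K"
  shows "\<delta> \<le> cop_number G * (K + 1)"
proof (rule ccontr)
  interpret fin_digraph G by fact
  assume "\<not> ?thesis"
  then have "\<not> cops_win G (cop_number G)"
    using robber_evades_few_cops[of G "cop_number G" K] assms wf_digraph_axioms
    by (metis linorder_not_le order_less_le_trans)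
  moreover have "cops_win G (cop_number G)"
    unfolding cop_number_def by (rule LeastI, rule cops_on_all_vertices_win) simp
  ultimately show False by blast
qed

section \<open>Diameter\<close>

text \<open>
  Along a walk, \<open>f\<close> grows by at most one per arc, so the length of a walk bounds the growth of \<open>f\<close>.
\<close>

lemma graph_diameter_ge_Lipschitz:
  fixes f :: "'a \<Rightarrow> nat"
  assumes "wf_digraph G" and "u \<in> verts G" "v \<in> verts G"
    and lip: "\<And>x y. x \<rightarrow>\<^bsub>G\<^esub> y \<Longrightarrow> f y \<le> Suc (f x)"
  shows "graph_diameter G \<ge> ereal (real (f v) - real (f u))"
proof -
  interpret wf_digraph G by fact
  have walk: "real (f v) - real (f x) \<le> awalk_cost (\<lambda>_. 1) p" if "awalk x p v" for x p
    using that
  proof (induction p arbitrary: x)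
    case Nil
    then show ?case by (simp add: awalk_Nil_iff)
  next
    case (Cons a p)
    then have "a \<in> arcs G" "tail G a = x" "awalk (head G a) p v"
      by (auto simp: awalk_Cons_iff)
    then have "f (head G a) \<le> Suc (f x)" "real (f v) - real (f (head G a)) \<le> awalk_cost (\<lambda>_. 1) p"
      using lip[of x "head G a"] Cons.IH by (auto simp: arcs_ends_conv)
    then show ?case by simp
  qed
  have "ereal (real (f v) - real (f u)) \<le> \<mu> (\<lambda>_. 1) u v"
    unfolding \<mu>_def by (rule INF_greatest) (use walk in auto)
  also have "\<dots> \<le> (SUP v \<in> verts G. \<mu> (\<lambda>_. 1) u v)"
    using assms by (intro SUP_upper)
  also have "\<dots> \<le> graph_diameter G"
    unfolding graph_diameter_def using assms by (intro SUP_upper)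
  finally show ?thesis .
qed

section \<open>Graphs with natural numbers as vertices\<close>

text \<open>
  Meyniel extremal families consist of graphs on natural numbers, whereas the vertices below are
  naturally triples. The relabelling by \<open>to_nat\<close> allows the work to be done on the triples.
\<close>

definition nat_graph :: "'a::countable set \<Rightarrow> ('a \<Rightarrow> 'a set) \<Rightarrow> nat pair_pre_digraph" where
  "nat_graph V N =
     \<lparr>pverts = to_nat ` V, parcs = {(to_nat u, to_nat v) | u v. u \<in> V \<and> v \<in> N u}\<rparr>"

lemma pverts_nat_graph [simp]: "pverts (nat_graph V N) = to_nat ` V"
  by (simp add: nat_graph_def)

lemma parcs_nat_graph_iff [simp]:
  "(to_nat u, to_nat v) \<in> parcs (nat_graph V N) \<longleftrightarrow> u \<in> V \<and> v \<in> N u"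
  by (auto simp: nat_graph_def)

lemma parcs_nat_graphE:
  assumes "(a, b) \<in> parcs (nat_graph V N)"
  obtains u v where "a = to_nat u" "b = to_nat v" "u \<in> V" "v \<in> N u"
  using assms by (auto simp: nat_graph_def)

lemma pair_graph_nat_graph:
  assumes "finite V"
    and closed: "\<And>u v. u \<in> V \<Longrightarrow> v \<in> N u \<Longrightarrow> v \<in> V"
    and irrefl: "\<And>u. u \<in> V \<Longrightarrow> u \<notin> N u"
    and sym: "\<And>u v. u \<in> V \<Longrightarrow> v \<in> N u \<Longrightarrow> u \<in> N v"
  shows "pair_graph (nat_graph V N)"
proof
  have sub: "parcs (nat_graph V N) \<subseteq> pverts (nat_graph V N) \<times> pverts (nat_graph V N)"
    using closed unfolding nat_graph_def by auto
  show "e \<in> parcs (nat_graph V N) \<Longrightarrow> fst e \<in> pverts (nat_graph V N)" for e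
    using sub by auto
  show "e \<in> parcs (nat_graph V N) \<Longrightarrow> snd e \<in> pverts (nat_graph V N)" for e
    using sub by auto
  show fin: "finite (pverts (nat_graph V N))"
    using assms by simp
  show "finite (parcs (nat_graph V N))"
    using finite_subset[OF sub] fin by blast
  show "e \<in> parcs (nat_graph V N) \<Longrightarrow> fst e \<noteq> snd e" for e
    using irrefl unfolding nat_graph_def by auto
  show "symmetric (nat_graph V N)"
    unfolding symmetric_def with_proj_simps
  proof (rule symI)
    fix a b assume "(a, b) \<in> parcs (nat_graph V N)"
    then obtain u v where uv: "a = to_nat u" "b = to_nat v" "u \<in> V" "v \<in> N u"
      by (rule parcs_nat_graphE)
    from closed[OF uv(3,4)] sym[OF uv(3,4)] show "(b, a) \<in> parcs (nat_graph V N)"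
      unfolding uv(1,2) parcs_nat_graph_iff ..
  qed
qed

lemma neighbours_nat_graph:
  "u \<in> V \<Longrightarrow> neighbours (nat_graph V N) (to_nat u) = to_nat ` N u"
  unfolding neighbours_def by (auto elim!: parcs_nat_graphE)

lemma out_degree_nat_graph:
  assumes "u \<in> V"
  shows "out_degree (nat_graph V N) (to_nat u) = card (N u)"
proof -
  have "out_arcs (nat_graph V N) (to_nat u) = Pair (to_nat u) ` to_nat ` N u"
    unfolding out_arcs_def using assms by (auto elim!: parcs_nat_graphE)
  then show ?thesis
    by (simp add: out_degree_def card_image inj_on_def)
qed

lemma graph_diameter_nat_graph_ge:
  fixes f :: "'a::countable \<Rightarrow> nat"
  assumes "pair_graph (nat_graph V N)" and "u \<in> V" "v \<in> V"
    and lip: "\<And>x y. x \<in> V \<Longrightarrow> y \<in> N x \<Longrightarrow> f y \<le> Suc (f x)"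
  shows "graph_diameter (nat_graph V N) \<ge> ereal (real (f v) - real (f u))"
proof -
  interpret pair_graph "nat_graph V N" by fact
  have "ereal (real (f (from_nat (to_nat v))) - real (f (from_nat (to_nat u))))
      \<le> graph_diameter (nat_graph V N)"
    by (rule graph_diameter_ge_Lipschitz[OF wf_digraph_axioms, where f = "\<lambda>a. f (from_nat a)"])
      (use assms in \<open>auto elim!: parcs_nat_graphE\<close>)
  then show ?thesis by simp
qed

section \<open>The cycle of layers\<close>

type_synonym vertex = "int \<times> int \<times> nat"

text \<open>
  The layers are \<open>0, \<dots>, 2 * d - 1\<close> in cyclic order. The steps from an even layer to the next one
  carry incidences and those from an odd layer carry matchings; \<open>inc_layer\<close> and \<open>twin_layer\<close> send
  a layer to the other end of its step of either kind.
\<close>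

definition inc_layer :: "nat \<Rightarrow> nat" where
  "inc_layer i = (if even i then Suc i else i - 1)"

definition twin_layer :: "nat \<Rightarrow> nat \<Rightarrow> nat" where
  "twin_layer d i =
     (if even i then if i = 0 then 2 * d - 1 else i - 1
      else if Suc i = 2 * d then 0 else Suc i)"

lemma inc_layer_less: "i < 2 * d \<Longrightarrow> inc_layer i < 2 * d"
  unfolding inc_layer_def by presburger

lemma inc_layer_inc_layer [simp]: "inc_layer (inc_layer i) = i"
  unfolding inc_layer_def by presburger

lemma inc_layer_neq: "i \<noteq> inc_layer i"
  unfolding inc_layer_def by presburger

lemma twin_layer_less: "i < 2 * d \<Longrightarrow> twin_layer d i < 2 * d"
  unfolding twin_layer_def by presburger

lemma twin_layer_twin_layer: "i < 2 * d \<Longrightarrow> twin_layer d (twin_layer d i) = i"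
  unfolding twin_layer_def by (cases "even i"; cases "i = 0"; cases "Suc i = 2 * d"; simp; presburger?)

lemma twin_layer_neq: "i < 2 * d \<Longrightarrow> i \<noteq> twin_layer d i"
  unfolding twin_layer_def by presburger

lemma twin_layer_neq_inc_layer: "2 \<le> d \<Longrightarrow> i < 2 * d \<Longrightarrow> twin_layer d i \<noteq> inc_layer i"
  unfolding twin_layer_def inc_layer_def by presburger

text \<open>
  The cyclic distance from layer \<open>0\<close>; it serves as the Lipschitz function bounding the diameter.
\<close>

definition height :: "nat \<Rightarrow> nat \<Rightarrow> nat" where
  "height d i = min i (2 * d - i)"

lemma height_inc_layer: "height d (inc_layer i) \<le> Suc (height d i)"
  by (auto simp: height_def inc_layer_def)

lemma height_twin_layer: "i < 2 * d \<Longrightarrow> height d (twin_layer d i) \<le> Suc (height d i)"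
  by (auto simp: height_def twin_layer_def)

section \<open>The layered graph of incidences\<close>

definition vertices :: "nat \<Rightarrow> nat \<Rightarrow> vertex set" where
  "vertices p d = {0..<int p} \<times> {0..<int p} \<times> {..<2 * d}"

fun twin :: "nat \<Rightarrow> vertex \<Rightarrow> vertex" where
  "twin d (x, y, i) = (x, y, twin_layer d i)"

text \<open>
  The lines \<open>(m, b)\<close> through the point \<open>(x, y)\<close>. Writing the equation as \<open>y + b = x * m\<close> modulo \<open>p\<close>
  makes it symmetric in \<open>(x, y)\<close> and \<open>(m, b)\<close>, so that points and lines need not be told apart.
\<close>

fun incident :: "nat \<Rightarrow> vertex \<Rightarrow> vertex set" where
  "incident p (x, y, i) =
     {(m, b, j). j = inc_layer i \<and> m \<in> {0..<int p} \<and> b \<in> {0..<int p} \<and> int p dvd y + b - x * m}"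

lemma int_mod_range: "0 < p \<Longrightarrow> z mod int p \<in> {0..<int p}"
  by simp

lemma eq_if_dvd_diff: "a = b" if "a \<in> {0..<int p}" "b \<in> {0..<int p}" "int p dvd a - b"
  using that by (metis atLeastLessThan_iff mod_eq_dvd_iff mod_pos_pos_trivial)

text \<open>
  A line through a given point is determined by its slope \<open>m\<close>, which is arbitrary.
\<close>

lemma incident_eq_image:
  assumes "0 < p"
  shows "incident p (x, y, i) = (\<lambda>m. (m, (x * m - y) mod int p, inc_layer i)) ` {0..<int p}"
proof -
  have *: "int p dvd y + b - x * m \<longleftrightarrow> b = (x * m - y) mod int p" if "b \<in> {0..<int p}" for b m
  proof -
    have "int p dvd y + b - x * m \<longleftrightarrow> b mod int p = (x * m - y) mod int p"
      by (simp add: mod_eq_dvd_iff algebra_simps)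
    then show ?thesis using that by simp
  qed
  show ?thesis using assms * int_mod_range[OF assms] by (auto 0 3)
qed

lemma card_incident: "0 < p \<Longrightarrow> card (incident p v) = p"
  by (cases v) (auto simp: incident_eq_image card_image inj_on_def simp del: incident.simps)

lemma finite_incident: "0 < p \<Longrightarrow> finite (incident p v)"
  by (cases v) (simp add: incident_eq_image del: incident.simps)

lemma incident_sym: "u \<in> vertices p d \<Longrightarrow> v \<in> incident p u \<Longrightarrow> u \<in> incident p v"
  by (cases u; cases v) (auto simp: vertices_def algebra_simps)

lemma incident_subset_vertices: "u \<in> vertices p d \<Longrightarrow> incident p u \<subseteq> vertices p d"
  by (cases u) (auto simp: vertices_def inc_layer_less)

lemma twin_in_vertices: "u \<in> vertices p d \<Longrightarrow> twin d u \<in> vertices p d"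
  by (cases u) (auto simp: vertices_def twin_layer_less)

lemma twin_twin: "u \<in> vertices p d \<Longrightarrow> twin d (twin d u) = u"
  by (cases u) (auto simp: vertices_def twin_layer_twin_layer)

text \<open>
  Two vertices incident to a common one are in the same layer, so only the coordinates matter.
  If \<open>(x, y)\<close> and \<open>(x', y')\<close> both lie on \<open>(m, b)\<close> and \<open>(m', b')\<close>, then the four equations combine to
  \<open>(x' - x) * (m - m') = 0\<close> modulo the prime \<open>p\<close>. Thus either the slopes agree, and with them the
  lines, or \<open>x = x'\<close> and the points agree.
\<close>

lemma common_incident_unique:
  assumes "prime p" "u \<in> vertices p d" "v \<in> vertices p d" "u \<noteq> v"
    and "w \<in> incident p u \<inter> incident p v" "w' \<in> incident p u \<inter> incident p v"
  shows "w = w'"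
proof -
  obtain x y i where u: "u = (x, y, i)" by (cases u)
  obtain x' y' i' where v: "v = (x', y', i')" by (cases v)
  obtain m b j where w: "w = (m, b, j)" by (cases w)
  obtain m' b' j' where w': "w' = (m', b', j')" by (cases w')
  have j: "j' = j" and i: "i' = i"
    using assms(5,6) inc_layer_inc_layer by (auto simp: u v w w') (metis inc_layer_inc_layer)
  have range: "x \<in> {0..<int p}" "x' \<in> {0..<int p}" "y \<in> {0..<int p}" "y' \<in> {0..<int p}"
       "m \<in> {0..<int p}" "m' \<in> {0..<int p}" "b \<in> {0..<int p}" "b' \<in> {0..<int p}"
    using assms(2,3,5,6) by (auto simp: u v w w' vertices_def)
  have inc: "int p dvd y + b - x * m" "int p dvd y' + b - x' * m"
       "int p dvd y + b' - x * m'" "int p dvd y' + b' - x' * m'"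
    using assms(5,6) by (auto simp: u v w w')
  have "(y + b - x * m) - (y' + b - x' * m) - ((y + b' - x * m') - (y' + b' - x' * m'))
      = (x' - x) * (m - m')"
    by (simp add: algebra_simps)
  then have "int p dvd (x' - x) * (m - m')"
    using inc by (metis dvd_diff)
  then have "int p dvd x' - x \<or> int p dvd m - m'"
    using \<open>prime p\<close> by (simp add: prime_dvd_mult_iff)
  then have "m = m'"
  proof
    assume "int p dvd x' - x"
    then have "x' = x" using eq_if_dvd_diff range by blast
    have "(y + b - x * m) - (y' + b - x' * m) = y - y'"
      using \<open>x' = x\<close> by simp
    then have "y = y'" using inc eq_if_dvd_diff range by (metis dvd_diff)
    then show ?thesis using \<open>u \<noteq> v\<close> \<open>x' = x\<close> i by (simp add: u v)
  qed (use eq_if_dvd_diff range in blast)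
  moreover have "(y + b - x * m) - (y + b' - x * m) = b - b'"
    by simp
  ultimately have "b = b'" using inc eq_if_dvd_diff range by (metis dvd_diff)
  then show ?thesis using \<open>m = m'\<close> j by (simp add: w w')
qed

definition nbrs :: "nat \<Rightarrow> nat \<Rightarrow> vertex \<Rightarrow> vertex set" where
  "nbrs p d u = insert (twin d u) (incident p u)"

lemma card_nbrs:
  assumes "0 < p" "2 \<le> d" "u \<in> vertices p d"
  shows "card (nbrs p d u) = Suc p"
proof -
  have "twin d u \<notin> incident p u"
    using assms by (cases u) (auto simp: vertices_def twin_layer_neq_inc_layer)
  then show ?thesis using assms by (simp add: nbrs_def card_incident finite_incident)
qed

text \<open>
  A common neighbour that is not the twin of \<open>u\<close> or \<open>v\<close> is incident to both.
\<close>

lemma card_common_nbrs: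
  assumes "prime p" "u \<in> vertices p d" "v \<in> vertices p d" "u \<noteq> v"
  shows "card (nbrs p d u \<inter> nbrs p d v) \<le> 3"
proof -
  let ?C = "incident p u \<inter> incident p v"
  have fin: "finite ?C" using finite_incident \<open>prime p\<close> prime_gt_0_nat by blast
  have "card ?C \<le> 1"
    using common_incident_unique[OF assms] by (intro card_le_Suc0_iff_eq[THEN iffD2, OF fin, folded One_nat_def]) blast
  then have "card (insert (twin d u) (insert (twin d v) ?C)) \<le> 3"
    using fin by (auto simp: card_insert_if)
  moreover have "card (nbrs p d u \<inter> nbrs p d v) \<le> card (insert (twin d u) (insert (twin d v) ?C))"
    using fin by (intro card_mono) (auto simp: nbrs_def)
  ultimately show ?thesis by linarith
qed

lemma nbrs_sym:
  assumes "u \<in> vertices p d" "v \<in> nbrs p d u"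
  shows "u \<in> nbrs p d v"
proof -
  have "v = twin d u \<or> v \<in> incident p u" using assms(2) by (simp add: nbrs_def)
  then show ?thesis
    using twin_twin[OF assms(1)] incident_sym[OF assms(1), of v] by (auto simp: nbrs_def)
qed

lemma nbrs_in_vertices: "u \<in> vertices p d \<Longrightarrow> v \<in> nbrs p d u \<Longrightarrow> v \<in> vertices p d"
  using twin_in_vertices[of u p d] incident_subset_vertices[of u p d] unfolding nbrs_def by blast

lemma not_in_own_nbrs: "u \<in> vertices p d \<Longrightarrow> u \<notin> nbrs p d u"
  by (cases u) (simp add: vertices_def nbrs_def twin_layer_neq inc_layer_neq)

lemma finite_vertices: "finite (vertices p d)"
  by (simp add: vertices_def)

lemma card_vertices: "card (vertices p d) = 2 * d * p\<^sup>2"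
  by (simp add: vertices_def card_cartesian_product power2_eq_square)

lemma origin_in_vertices: "0 < p \<Longrightarrow> i < 2 * d \<Longrightarrow> (0, 0, i) \<in> vertices p d"
  by (simp add: vertices_def)

definition layered_graph :: "nat \<Rightarrow> nat \<Rightarrow> nat pair_pre_digraph" where
  "layered_graph p d = nat_graph (vertices p d) (nbrs p d)"

lemma pair_graph_layered_graph: "pair_graph (layered_graph p d)"
  unfolding layered_graph_def
  by (intro pair_graph_nat_graph finite_vertices)
    (fact nbrs_in_vertices not_in_own_nbrs nbrs_sym)+

text \<open>
  Inside a pair of layers joined by incidences, \<open>(x, y)\<close> reaches \<open>(0, 0)\<close> in six steps, through
  lines \<open>[m, b]\<close> of the other layer:
  \<open>(x, y) - [0, -y] - (0, y) - [-y, -y] - (1, 0) - [0, 0] - (0, 0)\<close>.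
  The origins of consecutive layers are adjacent by either kind of edge.
\<close>

lemma reachable_origin:
  assumes "2 \<le> p" "u \<in> vertices p d"
  shows "to_nat u \<rightarrow>\<^sup>*\<^bsub>layered_graph p d\<^esub> to_nat (0 :: int, 0 :: int, 0 :: nat)"
proof -
  interpret pair_graph "layered_graph p d" by (rule pair_graph_layered_graph)
  define R where "R u v \<longleftrightarrow> to_nat u \<rightarrow>\<^sup>*\<^bsub>layered_graph p d\<^esub> to_nat v" for u v :: vertex
  have R_sym: "R v u" if "R u v" for u v
    using that symmetric_reachable' unfolding R_def by blast
  have R_trans [trans]: "R u w" if "R u v" "R v w" for u v w
    using that reachable_trans unfolding R_def by blast
  have arc: "R u v" if "u \<in> vertices p d" "v \<in> nbrs p d u" for u v
    unfolding R_def
  proof (rule reachable_adjI)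
    show "(to_nat u, to_nat v) \<in> parcs (layered_graph p d)"
      unfolding layered_graph_def parcs_nat_graph_iff using that by blast
  qed
  have inc: "R (x, y, i) (m, b, inc_layer i)"
    if "(x, y, i) \<in> vertices p d" "m \<in> {0..<int p}" "b \<in> {0..<int p}" "int p dvd y + b - x * m"
    for x y i m b
    by (rule arc) (use that in \<open>auto simp: nbrs_def\<close>)
  have inc': "R (m, b, inc_layer i) (x, y, i)"
    if "(x, y, i) \<in> vertices p d" "m \<in> {0..<int p}" "b \<in> {0..<int p}" "int p dvd y + b - x * m"
    for x y i m b
    by (rule R_sym[OF inc[OF that]])
  obtain x y i where u: "u = (x, y, i)" by (cases u)
  let ?j = "inc_layer i" and ?y = "(- y) mod int p"
  have i: "i < 2 * d" and y: "y \<in> {0..<int p}" and x: "x \<in> {0..<int p}"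
    using assms by (auto simp: u vertices_def)
  have dvd: "int p dvd y + ?y"
    by (simp add: dvd_eq_mod_eq_0 mod_simps)
  have pts: "(x, y, i) \<in> vertices p d" "(0, y, i) \<in> vertices p d"
      "(1, 0, i) \<in> vertices p d" "(0, 0, i) \<in> vertices p d"
    using i x y \<open>2 \<le> p\<close> by (auto simp: vertices_def)
  have coords: "0 \<in> {0..<int p}" "?y \<in> {0..<int p}"
    using \<open>2 \<le> p\<close> by auto
  have "R (x, y, i) (0, ?y, ?j)"
    by (rule inc[OF pts(1) coords(1,2)]) (use dvd in simp)
  also have "R (0, ?y, ?j) (0, y, i)"
    by (rule inc'[OF pts(2) coords(1,2)]) (use dvd in simp)
  also have "R (0, y, i) (?y, ?y, ?j)"
    by (rule inc[OF pts(2) coords(2,2)]) (use dvd in simp)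
  also have "R (?y, ?y, ?j) (1, 0, i)"
    using inc'[OF pts(3) coords(2,2)] by simp
  also have "R (1, 0, i) (0, 0, ?j)"
    using inc[OF pts(3) coords(1,1)] by simp
  also have "R (0, 0, ?j) (0, 0, i)"
    using inc'[OF pts(4) coords(1,1)] by simp
  also have "R (0, 0, i) (0, 0, 0)"
    using i
  proof (induction i)
    case 0
    then have "(0, 0, 0) \<in> vertices p d"
      using \<open>2 \<le> p\<close> by (simp add: origin_in_vertices)
    then show ?case
      unfolding R_def by (intro reachable_refl) (simp add: layered_graph_def)
  next
    case (Suc i)
    have "R (0, 0, Suc i) (0, 0, i)"
    proof (rule arc)
      show "(0, 0, Suc i) \<in> vertices p d"
        using Suc.prems \<open>2 \<le> p\<close> by (simp add: origin_in_vertices)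
      show "(0, 0, i) \<in> nbrs p d (0, 0, Suc i)"
        using \<open>2 \<le> p\<close> Suc.prems
        by (cases "even i") (simp_all add: nbrs_def inc_layer_def twin_layer_def)
    qed
    also have "R (0, 0, i) (0, 0, 0)" using Suc by simp
    finally show ?case .
  qed
  finally show ?thesis
    unfolding u R_def .
qed

lemma connected_layered_graph:
  assumes "2 \<le> p" "0 < d"
  shows "Digraph_Component.connected (layered_graph p d)"
proof -
  interpret pair_graph "layered_graph p d" by (rule pair_graph_layered_graph)
  let ?o = "to_nat (0 :: int, 0 :: int, 0 :: nat)"
  have to_origin: "a \<rightarrow>\<^sup>*\<^bsub>layered_graph p d\<^esub> ?o" if "a \<in> verts (layered_graph p d)" for a
    using that reachable_origin[OF assms(1)] by (auto simp: layered_graph_def)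
  show ?thesis
    unfolding Digraph_Component.connected_def
  proof (rule strongly_connectedI)
    show "verts (mk_symmetric (layered_graph p d)) \<noteq> {}"
      using assms origin_in_vertices[of p 0 d] by (auto simp: layered_graph_def)
    fix a b
    assume "a \<in> verts (mk_symmetric (layered_graph p d))" "b \<in> verts (mk_symmetric (layered_graph p d))"
    then have "a \<rightarrow>\<^sup>*\<^bsub>layered_graph p d\<^esub> ?o" "?o \<rightarrow>\<^sup>*\<^bsub>layered_graph p d\<^esub> b"
      using to_origin symmetric_reachable'[OF to_origin[of b]] by simp_all
    then show "a \<rightarrow>\<^sup>*\<^bsub>mk_symmetric (layered_graph p d)\<^esub> b"
      by (intro reachable_mk_symmetricI) (rule reachable_trans)
  qed
qed

lemma diameter_layered_graph:
  assumes "0 < p" "0 < d"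
  shows "graph_diameter (layered_graph p d) \<ge> ereal (real d)"
proof -
  let ?h = "\<lambda>v :: vertex. height d (snd (snd v))"
  have "ereal (real (?h (0, 0, d)) - real (?h (0, 0, 0))) \<le> graph_diameter (layered_graph p d)"
    unfolding layered_graph_def
  proof (rule graph_diameter_nat_graph_ge)
    show "pair_graph (nat_graph (vertices p d) (nbrs p d))"
      using pair_graph_layered_graph by (simp add: layered_graph_def)
    show "?h v \<le> Suc (?h u)" if "u \<in> vertices p d" "v \<in> nbrs p d u" for u v
      using that by (cases u) (auto simp: nbrs_def vertices_def height_inc_layer height_twin_layer)
  qed (use assms origin_in_vertices in auto)
  then show ?thesis by (simp add: height_def)
qed

lemma regular_layered_graph:
  assumes "0 < p" "2 \<le> d"
  shows "regular (layered_graph p d)"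
  using card_nbrs[OF assms] by (auto simp: regular_def layered_graph_def out_degree_nat_graph)

lemma cop_number_layered_graph:
  assumes "prime p" "2 \<le> d"
  shows "Suc p \<le> 4 * cop_number (layered_graph p d)"
proof -
  interpret pair_graph "layered_graph p d" by (rule pair_graph_layered_graph)
  have p: "0 < p" using assms(1) by (rule prime_gt_0_nat)
  have "Suc p \<le> cop_number (layered_graph p d) * (3 + 1)"
  proof (rule cop_number_ge_degree_over_codegree)
    show "fin_digraph (layered_graph p d)" by (rule fin_digraph_axioms)
    show "verts (layered_graph p d) \<noteq> {}"
      using p assms origin_in_vertices[of p 0 d] by (auto simp: layered_graph_def)
  next
    fix a assume "a \<in> verts (layered_graph p d)"
    then obtain u where u: "u \<in> vertices p d" "a = to_nat u"
      unfolding layered_graph_def with_proj_simps pverts_nat_graph by blast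
    then show "Suc p \<le> card (neighbours (layered_graph p d) a)"
      using card_nbrs[OF p assms(2) u(1)]
      by (simp add: layered_graph_def neighbours_nat_graph card_image)
  next
    fix a b
    assume *: "a \<in> verts (layered_graph p d)" "b \<in> verts (layered_graph p d)" and "a \<noteq> b"
    obtain u v where uv: "u \<in> vertices p d" "v \<in> vertices p d" "a = to_nat u" "b = to_nat v"
      using * unfolding layered_graph_def with_proj_simps pverts_nat_graph by blast
    then have "u \<noteq> v" using \<open>a \<noteq> b\<close> by blast
    have "neighbours (layered_graph p d) a \<inter> neighbours (layered_graph p d) b
        = to_nat ` (nbrs p d u \<inter> nbrs p d v)"
      using uv by (simp add: layered_graph_def neighbours_nat_graph image_Int)
    then show "card (neighbours (layered_graph p d) a \<inter> neighbours (layered_graph p d) b) \<le> 3"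
      using card_common_nbrs[OF assms(1) uv(1,2) \<open>u \<noteq> v\<close>] by (simp add: card_image)
  qed
  then show ?thesis by simp
qed

theorem corollary24:
  fixes d :: nat
  assumes "d \<ge> 3"
  shows "\<exists>I G. Meyniel_extremal I G \<and>
           (\<forall>n \<in> I. regular (with_proj (G n)) \<and>
                    graph_diameter (with_proj (G n)) \<ge> ereal (real d))"
proof -
  (* The order determines the prime, so the graph can be indexed by its order. *)
  define ord where "ord p = 2 * d * p\<^sup>2" for p :: nat
  define G where "G n = layered_graph (inv ord n) d" for n
  have inj: "inj ord"
    using assms by (auto simp: ord_def inj_on_def power2_eq_iff)
  then have G_ord [simp]: "G (ord p) = layered_graph p d" for p
    by (simp add: G_def)
  have "Meyniel_extremal (ord ` {p. prime p}) G"
    unfolding Meyniel_extremal_def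
  proof (intro conjI ballI)
    show "infinite (ord ` {p. prime p})"
      using primes_infinite inj by (simp add: finite_image_iff inj_on_subset)
    show "0 \<notin> ord ` {p. prime p}"
      using assms by (auto simp: ord_def)
  next
    fix n assume "n \<in> ord ` {p. prime p}"
    then obtain p where p: "prime p" and n [simp]: "n = ord p" by blast
    show "pair_graph (G n)" by (simp add: pair_graph_layered_graph)
    show "Digraph_Component.connected (G n)"
      using assms prime_ge_2_nat[OF p] by (simp add: connected_layered_graph)
    show "card (pverts (G n)) = n"
      unfolding n G_ord by (simp add: layered_graph_def card_image card_vertices ord_def)
  next
    show "\<exists>a>0. \<forall>n\<in>ord ` {p. prime p}. a * sqrt (real n) \<le> real (cop_number (G n))"
    proof (intro exI[of _ "1 / (4 * sqrt (2 * real d))"] conjI ballI)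
      show "0 < 1 / (4 * sqrt (2 * real d))" using assms by simp
      fix n assume "n \<in> ord ` {p. prime p}"
      then obtain p where p: "prime p" and n [simp]: "n = ord p" by blast
      have "1 / (4 * sqrt (2 * real d)) * sqrt (real n) = real p / 4"
        using assms by (simp add: ord_def real_sqrt_mult)
      also have "\<dots> \<le> real (cop_number (G n))"
        using cop_number_layered_graph[OF p, of d] assms by simp
      finally show "1 / (4 * sqrt (2 * real d)) * sqrt (real n) \<le> real (cop_number (G n))" .
    qed
  qed
  moreover have "regular (G n) \<and> graph_diameter (G n) \<ge> ereal (real d)"
    if "n \<in> ord ` {p. prime p}" for n
    using that assms prime_gt_0_nat by (auto simp: regular_layered_graph diameter_layered_graph)
  ultimately show ?thesis by blast
qed

end
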